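(* Let $\lambda$ be a monadic stream GSOS specification over a signature $\Sigma$ and output set $A$, let $\mathcal V$ be a set of variables, and let $m_\lambda$ be the Mealy machine on $T\mathcal V$ defined below. Then the function $(-)_{\forall\theta}$ on relations is $\mathbf b$-compatible: for every relation $R\subseteq T\mathcal V\times T\mathcal V$, $$(\mathbf b(R))_{\forall\theta}\subseteq\mathbf b(R_{\forall\theta}).$$
   Context: A signature $\Sigma$ is a set of operation symbols with finite arities; $T\mathcal V$ is the set of $\Sigma$-terms over variables $\mathcal V$. A substitution $\theta:\mathcal V\to T\mathcal V$ extends to $T\mathcal V\to T\mathcal V$ by replacing each variable $\mathcal X$ with $\theta(\mathcal X)$. A monadic stream GSOS specification for $\Sigma$ and $A$ is a set of rules $\frac{x_1\xrightarrow{a_1}x_1'\cdots x_n\xrightarrow{a_n}x_n'}{f(x_1,\dots,x_n)\xrightarrow{a}t}$ ($f$ of arity $n$, pairwise distinct variables, $t$ a $\Sigma$-term over $\{x_1',\dots,x_n'\}$ only) such that for each $f$ and each $(a_1,\dots,a_n)\in A^n$ exactly one rule for $f$ has premise labels $(a_1,\dots,a_n)$. The Mealy machine $m_\lambda$, $m_\lambda(t)(\varsigma)=(o_t(\varsigma),d_t(\varsigma))$ for inputs $\varsigma:\mathcal V\to A$, written $t\xrightarrow{\varsigma\mid o_t(\varsigma)}d_t(\varsigma)$, is defined inductively: $\mathcal X\xrightarrow{\varsigma\mid\varsigma(\mathcal X)}\mathcal X$ for variables, and $f(t_1,\dots,t_n)\xrightarrow{\varsigma\mid a}t[t_1'/x_1',\dots,t_n'/x_n']$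 whenever $t_i\xrightarrow{\varsigma\mid a_i}t_i'$ and the rule for $f$ with premise labels $(a_1,\dots,a_n)$ has conclusion $f(\vec x)\xrightarrow{a}t$. For $R\subseteq T\mathcal V\times T\mathcal V$: $\mathbf b(R)=\{(s,t)\mid\forall\varsigma\in A^{\mathcal V},\ o_s(\varsigma)=o_t(\varsigma)\text{ and }(d_s(\varsigma),d_t(\varsigma))\in R\}$, and $R_{\forall\theta}=\{(\theta(t_1),\theta(t_2))\mid\theta:\mathcal V\to T\mathcal V,\ (t_1,t_2)\in R\}$. *)

theory Defs
  imports Main "HOL-Library.FuncSet"
begin

text \<open>
  A signature is a partial map \<open>\<Sigma>\<close> sending each of its operation symbols (the domain of \<open>\<Sigma>\<close>)
  to its arity.  The sets \<open>\<V>\<close> of variables and \<open>A\<close> of outputs are explicit carriers, so each of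
  them, like the signature, may be empty.
\<close>

datatype ('f, 'v) trm = Var 'v | Op 'f "('f, 'v) trm list"

inductive_set terms :: "('f \<rightharpoonup> nat) \<Rightarrow> 'v set \<Rightarrow> ('f, 'v) trm set"
  for \<Sigma> :: "'f \<rightharpoonup> nat" and V :: "'v set" where
  Var: "x \<in> V \<Longrightarrow> Var x \<in> terms \<Sigma> V"
| Op: "\<Sigma> f = Some (length ts) \<Longrightarrow> (\<And>t. t \<in> set ts \<Longrightarrow> t \<in> terms \<Sigma> V) \<Longrightarrow> Op f ts \<in> terms \<Sigma> V"

primrec subst :: "('x \<Rightarrow> ('f, 'v) trm) \<Rightarrow> ('f, 'x) trm \<Rightarrow> ('f, 'v) trm" where
  "subst \<theta> (Var x) = \<theta> x"
| "subst \<theta> (Op f ts) = Op f (map (subst \<theta>) ts)"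

text \<open>
  \<open>Rule f [(x\<^sub>1, a\<^sub>1, y\<^sub>1), \<dots>, (x\<^sub>n, a\<^sub>n, y\<^sub>n)] a t\<close> stands for the rule with premises
  \<open>x\<^sub>i \<midarrow>a\<^sub>i\<rightarrow> y\<^sub>i\<close> and conclusion \<open>f(x\<^sub>1, \<dots>, x\<^sub>n) \<midarrow>a\<rightarrow> t\<close>.  Rule variables have
  their own type \<open>'x\<close>, unrelated to the variables of the terms on which the rules act.
\<close>

datatype ('f, 'a, 'x) gsos_rule =
  Rule (rule_op: 'f) (rule_prems: "('x \<times> 'a \<times> 'x) list") (out_label: 'a) (out_term: "('f, 'x) trm")

definition sources :: "('f, 'a, 'x) gsos_rule \<Rightarrow> 'x list" where
  "sources r = map (\<lambda>(x, a, y). x) (rule_prems r)"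

definition labels :: "('f, 'a, 'x) gsos_rule \<Rightarrow> 'a list" where
  "labels r = map (\<lambda>(x, a, y). a) (rule_prems r)"

definition targets :: "('f, 'a, 'x) gsos_rule \<Rightarrow> 'x list" where
  "targets r = map (\<lambda>(x, a, y). y) (rule_prems r)"

definition monadic_stream_rule :: "('f \<rightharpoonup> nat) \<Rightarrow> 'a set \<Rightarrow> ('f, 'a, 'x) gsos_rule \<Rightarrow> bool" where
  "monadic_stream_rule \<Sigma> A r \<longleftrightarrow>
     \<Sigma> (rule_op r) = Some (length (rule_prems r)) \<and>
     distinct (sources r @ targets r) \<and>
     set (labels r) \<subseteq> A \<and> out_label r \<in> A \<and>
     out_term r \<in> terms \<Sigma> (set (targets r))"

definition monadic_stream_GSOS :: "('f \<rightharpoonup> nat) \<Rightarrow> 'a set \<Rightarrow> ('f, 'a, 'x) gsos_rule set \<Rightarrow> bool" where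
  "monadic_stream_GSOS \<Sigma> A \<Lambda> \<longleftrightarrow>
     (\<forall>r\<in>\<Lambda>. monadic_stream_rule \<Sigma> A r) \<and>
     (\<forall>f n as. \<Sigma> f = Some n \<and> length as = n \<and> set as \<subseteq> A \<longrightarrow>
        (\<exists>!r. r \<in> \<Lambda> \<and> rule_op r = f \<and> labels r = as))"

text \<open>
  \<open>mealy_step \<Lambda> \<sigma> t (a, t')\<close> is the transition from \<open>t\<close> to \<open>t'\<close> with input \<open>\<sigma>\<close> and output \<open>a\<close>.
  In the second clause \<open>ps\<close> lists the pairs of output and successor of the arguments, and
  every variable of \<open>out_term r\<close> is one of \<open>targets r\<close>, so \<open>the\<close> is never applied to \<open>None\<close>.
\<close>

inductive mealy_step ::
  "('f, 'a, 'x) gsos_rule set \<Rightarrow> ('v \<Rightarrow> 'a) \<Rightarrow> ('f, 'v) trm \<Rightarrow> 'a \<times> ('f, 'v) trm \<Rightarrow> bool"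
  for \<Lambda> :: "('f, 'a, 'x) gsos_rule set" and \<sigma> :: "'v \<Rightarrow> 'a" where
  Var: "mealy_step \<Lambda> \<sigma> (Var x) (\<sigma> x, Var x)"
| Op: "list_all2 (mealy_step \<Lambda> \<sigma>) ts ps \<Longrightarrow>
       r \<in> \<Lambda> \<Longrightarrow> rule_op r = f \<Longrightarrow> labels r = map fst ps \<Longrightarrow>
       mealy_step \<Lambda> \<sigma> (Op f ts)
         (out_label r, subst (\<lambda>y. the (map_of (zip (targets r) (map snd ps)) y)) (out_term r))"

definition mealy ::
  "('f, 'a, 'x) gsos_rule set \<Rightarrow> ('f, 'v) trm \<Rightarrow> ('v \<Rightarrow> 'a) \<Rightarrow> 'a \<times> ('f, 'v) trm" where
  "mealy \<Lambda> t \<sigma> = (THE p. mealy_step \<Lambda> \<sigma> t p)"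

definition mealy_out :: "('f, 'a, 'x) gsos_rule set \<Rightarrow> ('f, 'v) trm \<Rightarrow> ('v \<Rightarrow> 'a) \<Rightarrow> 'a" where
  "mealy_out \<Lambda> t \<sigma> = fst (mealy \<Lambda> t \<sigma>)"

definition mealy_deriv :: "('f, 'a, 'x) gsos_rule set \<Rightarrow> ('f, 'v) trm \<Rightarrow> ('v \<Rightarrow> 'a) \<Rightarrow> ('f, 'v) trm" where
  "mealy_deriv \<Lambda> t \<sigma> = snd (mealy \<Lambda> t \<sigma>)"

text \<open>
  Inputs and substitutions range over total functions mapping the carrier \<open>V\<close> into \<open>A\<close> and into
  the terms over \<open>V\<close>, respectively; their values outside \<open>V\<close> do not matter.
\<close>

definition bisim_fun :: "('f \<rightharpoonup> nat) \<Rightarrow> 'v set \<Rightarrow> 'a set \<Rightarrow> ('f, 'a, 'x) gsos_rule set \<Rightarrow>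
    ('f, 'v) trm rel \<Rightarrow> ('f, 'v) trm rel" where
  "bisim_fun \<Sigma> V A \<Lambda> R =
     {(s, t) \<in> terms \<Sigma> V \<times> terms \<Sigma> V.
        \<forall>\<sigma> \<in> V \<rightarrow> A. mealy_out \<Lambda> s \<sigma> = mealy_out \<Lambda> t \<sigma> \<and> (mealy_deriv \<Lambda> s \<sigma>, mealy_deriv \<Lambda> t \<sigma>) \<in> R}"

definition subst_closure :: "('f \<rightharpoonup> nat) \<Rightarrow> 'v set \<Rightarrow> ('f, 'v) trm rel \<Rightarrow> ('f, 'v) trm rel" where
  "subst_closure \<Sigma> V R =
     {(subst \<theta> s, subst \<theta> t) | \<theta> s t. \<theta> \<in> V \<rightarrow> terms \<Sigma> V \<and> (s, t) \<in> R}"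

text \<open>The description operator in the definition of \<open>mealy\<close> denotes: the transition relation is a
  total function on terms, with values in \<open>A\<close> paired with terms.\<close>

lemma subst_in_terms:
  assumes "t \<in> terms \<Sigma> X" "\<And>x. x \<in> X \<Longrightarrow> \<theta> x \<in> terms \<Sigma> V"
  shows "subst \<theta> t \<in> terms \<Sigma> V"
  using assms by (induction rule: terms.induct) (auto intro!: terms.Op)

lemma mealy_step_ex1:
  assumes spec: "monadic_stream_GSOS \<Sigma> A \<Lambda>" and "\<sigma> \<in> V \<rightarrow> A" and "t \<in> terms \<Sigma> V"
  shows "\<exists>p \<in> A \<times> terms \<Sigma> V. \<forall>q. mealy_step \<Lambda> \<sigma> t q \<longleftrightarrow> q = p"
  using assms(3)
proof (induction rule: terms.induct)
  case (Var x)
  show ?case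
    by (rule bexI[of _ "(\<sigma> x, Var x)"])
      (use Var assms(2) in \<open>auto elim: mealy_step.cases intro: mealy_step.Var terms.Var\<close>)
next
  case (Op f ts)
  then obtain P where P: "\<And>t. t \<in> set ts \<Longrightarrow> P t \<in> A \<times> terms \<Sigma> V \<and> (\<forall>q. mealy_step \<Lambda> \<sigma> t q \<longleftrightarrow> q = P t)"
    by metis
  define ps where "ps = map P ts"
  have nth: "mealy_step \<Lambda> \<sigma> (ts ! i) q \<longleftrightarrow> q = P (ts ! i)" if "i < length ts" for i q
    using P[OF nth_mem[OF that]] by blast
  have all2: "list_all2 (mealy_step \<Lambda> \<sigma>) ts qs \<longleftrightarrow> qs = ps" for qs
    by (auto simp: ps_def list_all2_conv_all_nth list_eq_iff_nth_eq nth simp del: split_paired_All)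
  have "set (map fst ps) \<subseteq> A" "length (map fst ps) = length ts"
    using P by (auto simp: ps_def mem_Times_iff)
  then have "\<exists>!r. r \<in> \<Lambda> \<and> rule_op r = f \<and> labels r = map fst ps"
    using spec Op(1) unfolding monadic_stream_GSOS_def by blast
  then obtain r where r: "r \<in> \<Lambda>" "rule_op r = f" "labels r = map fst ps"
    and uniq: "\<And>r'. r' \<in> \<Lambda> \<Longrightarrow> rule_op r' = f \<Longrightarrow> labels r' = map fst ps \<Longrightarrow> r' = r"
    by blast
  let ?\<tau> = "\<lambda>y. the (map_of (zip (targets r) (map snd ps)) y)"
  have wf: "monadic_stream_rule \<Sigma> A r"
    using spec r(1) unfolding monadic_stream_GSOS_def by blast
  then have len: "length (targets r) = length ps"
    using Op(1) r(2) by (simp add: monadic_stream_rule_def targets_def ps_def)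
  have \<tau>: "?\<tau> y \<in> terms \<Sigma> V" if "y \<in> set (targets r)" for y
  proof -
    from that len obtain u where u: "map_of (zip (targets r) (map snd ps)) y = Some u"
      by (metis length_map map_of_zip_is_Some)
    then have "u \<in> snd ` set ps"
      using map_of_SomeD set_zip_rightD by fastforce
    then show ?thesis
      using u P by (auto simp: ps_def mem_Times_iff)
  qed
  have iff: "mealy_step \<Lambda> \<sigma> (Op f ts) q \<longleftrightarrow> q = (out_label r, subst ?\<tau> (out_term r))" for q
  proof
    assume "mealy_step \<Lambda> \<sigma> (Op f ts) q"
    then show "q = (out_label r, subst ?\<tau> (out_term r))"
    proof cases
      case (Op qs r')
      then have "qs = ps" using all2 by simp
      moreover from this have "r' = r" using Op uniq by simp
      ultimately show ?thesis using Op by simp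
    qed
  next
    assume "q = (out_label r, subst ?\<tau> (out_term r))"
    then show "mealy_step \<Lambda> \<sigma> (Op f ts) q"
      using mealy_step.Op[of \<Lambda> \<sigma> ts ps r f] all2 r by simp
  qed
  have "subst ?\<tau> (out_term r) \<in> terms \<Sigma> V"
    by (rule subst_in_terms[of _ _ "set (targets r)"])
      (use wf \<tau> in \<open>auto simp: monadic_stream_rule_def\<close>)
  moreover have "out_label r \<in> A"
    using wf by (simp add: monadic_stream_rule_def)
  ultimately show ?case
    using iff by blast
qed

end

theory Submission
  imports Defs
begin

text \<open>
  A step of \<open>\<theta>(t)\<close> on input \<open>\<sigma>\<close> is a step of \<open>t\<close> in which each variable \<open>x\<close> reads the output of
  \<open>\<theta>(x)\<close> on \<open>\<sigma>\<close>; the successor is the successor of \<open>t\<close> with each \<open>x\<close> replaced by the successor of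
  \<open>\<theta>(x)\<close>.  So for \<open>\<sigma>'(x) = o\<^bsub>\<theta>(x)\<^esub>(\<sigma>)\<close> and \<open>\<theta>'(x) = d\<^bsub>\<theta>(x)\<^esub>(\<sigma>)\<close>, which depend only on \<open>\<theta>\<close> and \<open>\<sigma>\<close>,
  the step of \<open>\<theta>(t)\<close> on \<open>\<sigma>\<close> has output \<open>o\<^bsub>t\<^esub>(\<sigma>')\<close> and successor \<open>\<theta>'(d\<^bsub>t\<^esub>(\<sigma>'))\<close>.  If \<open>s\<close> and \<open>t\<close> are
  related by \<open>bisim_fun\<close>, compare them on \<open>\<sigma>'\<close> and substitute \<open>\<theta>'\<close> in the successors.
\<close>

lemma subst_subst: "subst \<theta> (subst \<tau> t) = subst (\<lambda>x. subst \<theta> (\<tau> x)) t"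
  by (induction t) auto

lemma subst_cong_terms:
  assumes "t \<in> terms \<Sigma> X" "\<And>x. x \<in> X \<Longrightarrow> \<theta> x = \<theta>' x"
  shows "subst \<theta> t = subst \<theta>' t"
  using assms by (induction rule: terms.induct) auto

text \<open>The assumptions make the lookup succeed; a failed one would give
  \<open>the None\<close>, which \<open>g\<close> need not fix.\<close>

lemma the_map_of_zip_map:
  assumes "length ys = length us" "y \<in> set ys"
  shows "the (map_of (zip ys (map g us)) y) = g (the (map_of (zip ys us) y))"
  using assms by (induction ys us rule: list_induct2) auto

text \<open>Trades the description operator in \<open>mealy\<close> for the relation
  \<open>mealy_step\<close>, on which induction is available.\<close>

lemma mealy_step_mealy:
  assumes "monadic_stream_GSOS \<Sigma> A \<Lambda>" "\<sigma> \<in> V \<rightarrow> A" "t \<in> terms \<Sigma> V"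
  shows "mealy_step \<Lambda> \<sigma> t p \<longleftrightarrow> p = mealy \<Lambda> t \<sigma>"
    and "mealy \<Lambda> t \<sigma> \<in> A \<times> terms \<Sigma> V"
proof -
  obtain q where q: "q \<in> A \<times> terms \<Sigma> V" "\<And>p. mealy_step \<Lambda> \<sigma> t p \<longleftrightarrow> p = q"
    using mealy_step_ex1[OF assms] by blast
  then have "mealy \<Lambda> t \<sigma> = q"
    by (simp add: mealy_def)
  with q show "mealy_step \<Lambda> \<sigma> t p \<longleftrightarrow> p = mealy \<Lambda> t \<sigma>" "mealy \<Lambda> t \<sigma> \<in> A \<times> terms \<Sigma> V"
    by auto
qed

text \<open>Induction on the step of \<open>t\<close>: the arguments keep their outputs under
  substitution, so the same rule fires at each operation symbol.\<close>

lemma mealy_step_subst: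
  fixes \<theta> \<theta>' :: "'u \<Rightarrow> ('f, 'v) trm"
  assumes wf: "\<And>r. r \<in> \<Lambda> \<Longrightarrow> monadic_stream_rule \<Sigma> A r"
    and vars: "\<And>x. x \<in> U \<Longrightarrow> mealy_step \<Lambda> \<sigma> (\<theta> x) (\<sigma>' x, \<theta>' x)"
    and "mealy_step \<Lambda> \<sigma>' t p" "t \<in> terms \<Sigma> U"
  shows "mealy_step \<Lambda> \<sigma> (subst \<theta> t) (map_prod id (subst \<theta>') p)"
  using assms(3,4)
proof (induction rule: mealy_step.induct)
  case (Var x)
  then show ?case
    by (auto elim: terms.cases intro: vars)
next
  case (Op ts ps r f)
  let ?ps = "map (map_prod id (subst \<theta>')) ps"
  let ?ys = "targets r"
  from Op.prems have "t \<in> terms \<Sigma> U" if "t \<in> set ts" for t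
    using that by (auto elim: terms.cases)
  with Op.IH have args: "list_all2 (mealy_step \<Lambda> \<sigma>) (map (subst \<theta>) ts) ?ps"
    by (auto simp: list_all2_conv_all_nth id_def)
  have len: "length ?ys = length (map snd ps)"
    using arg_cong[OF Op.hyps(3), of length] by (simp add: labels_def targets_def)
  have step: "mealy_step \<Lambda> \<sigma> (subst \<theta> (Op f ts))
      (out_label r, subst (\<lambda>y. the (map_of (zip ?ys (map snd ?ps)) y)) (out_term r))"
    using mealy_step.Op[OF args, of r f] Op.hyps by (simp add: comp_def)
  have snd_ps: "map snd ?ps = map (subst \<theta>') (map snd ps)"
    by simp
  \<comment> \<open>Monadicity enters here: all variables of \<open>out_term r\<close> are targets,
    so \<open>\<theta>'\<close> acts only on the successors plugged in for them.\<close>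
  have "subst \<theta>' (subst (\<lambda>y. the (map_of (zip ?ys (map snd ps)) y)) (out_term r))
      = subst (\<lambda>y. the (map_of (zip ?ys (map snd ?ps)) y)) (out_term r)"
    unfolding subst_subst snd_ps
  proof (rule subst_cong_terms)
    show "out_term r \<in> terms \<Sigma> (set ?ys)"
      using wf[OF Op.hyps(1)] by (simp add: monadic_stream_rule_def)
  qed (simp only: the_map_of_zip_map[OF len])
  with step show ?case
    by simp
qed

lemma mealy_subst:
  assumes spec: "monadic_stream_GSOS \<Sigma> A \<Lambda>" and \<sigma>: "\<sigma> \<in> V \<rightarrow> A"
    and \<theta>: "\<theta> \<in> U \<rightarrow> terms \<Sigma> V" and t: "t \<in> terms \<Sigma> U"
  defines "\<sigma>' \<equiv> \<lambda>x. mealy_out \<Lambda> (\<theta> x) \<sigma>" and "\<theta>' \<equiv> \<lambda>x. mealy_deriv \<Lambda> (\<theta> x) \<sigma>"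
  shows "mealy_out \<Lambda> (subst \<theta> t) \<sigma> = mealy_out \<Lambda> t \<sigma>'"
    and "mealy_deriv \<Lambda> (subst \<theta> t) \<sigma> = subst \<theta>' (mealy_deriv \<Lambda> t \<sigma>')"
    and "\<sigma>' \<in> U \<rightarrow> A" and "\<theta>' \<in> U \<rightarrow> terms \<Sigma> V"
proof -
  have \<theta>x: "mealy \<Lambda> (\<theta> x) \<sigma> \<in> A \<times> terms \<Sigma> V" "mealy_step \<Lambda> \<sigma> (\<theta> x) (\<sigma>' x, \<theta>' x)"
    if "x \<in> U" for x
    using mealy_step_mealy[OF spec \<sigma> funcset_mem[OF \<theta> that]]
    by (simp_all add: \<sigma>'_def \<theta>'_def mealy_out_def mealy_deriv_def)
  then show \<sigma>': "\<sigma>' \<in> U \<rightarrow> A" and "\<theta>' \<in> U \<rightarrow> terms \<Sigma> V"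
    by (auto simp: \<sigma>'_def \<theta>'_def mealy_out_def mealy_deriv_def mem_Times_iff)
  have "mealy_step \<Lambda> \<sigma> (subst \<theta> t) (map_prod id (subst \<theta>') (mealy \<Lambda> t \<sigma>'))"
  proof (rule mealy_step_subst)
    show "mealy_step \<Lambda> \<sigma>' t (mealy \<Lambda> t \<sigma>')"
      using mealy_step_mealy(1)[OF spec \<sigma>' t] by blast
  qed (use spec \<theta>x(2) t in \<open>auto simp: monadic_stream_GSOS_def\<close>)
  moreover have "subst \<theta> t \<in> terms \<Sigma> V"
    using subst_in_terms[OF t] \<theta> by blast
  \<comment> \<open>By determinism the step just constructed is the only one of
    \<open>subst \<theta> t\<close>.\<close>
  ultimately have "mealy \<Lambda> (subst \<theta> t) \<sigma> = map_prod id (subst \<theta>') (mealy \<Lambda> t \<sigma>')"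
    using mealy_step_mealy(1)[OF spec \<sigma>] by metis
  then show "mealy_out \<Lambda> (subst \<theta> t) \<sigma> = mealy_out \<Lambda> t \<sigma>'"
    and "mealy_deriv \<Lambda> (subst \<theta> t) \<sigma> = subst \<theta>' (mealy_deriv \<Lambda> t \<sigma>')"
    by (simp_all add: mealy_out_def mealy_deriv_def)
qed

theorem theorem5:
  fixes \<Sigma> :: "'f \<rightharpoonup> nat" and V :: "'v set" and A :: "'a set"
    and \<Lambda> :: "('f, 'a, 'x) gsos_rule set" and R :: "('f, 'v) trm rel"
  assumes "monadic_stream_GSOS \<Sigma> A \<Lambda>"
    and "R \<subseteq> terms \<Sigma> V \<times> terms \<Sigma> V"
  shows "subst_closure \<Sigma> V (bisim_fun \<Sigma> V A \<Lambda> R) \<subseteq> bisim_fun \<Sigma> V A \<Lambda> (subst_closure \<Sigma> V R)"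
proof
  fix p assume "p \<in> subst_closure \<Sigma> V (bisim_fun \<Sigma> V A \<Lambda> R)"
  then obtain \<theta> s t where p: "p = (subst \<theta> s, subst \<theta> t)" and \<theta>: "\<theta> \<in> V \<rightarrow> terms \<Sigma> V"
    and st: "s \<in> terms \<Sigma> V" "t \<in> terms \<Sigma> V"
    and b: "\<And>\<sigma>. \<sigma> \<in> V \<rightarrow> A \<Longrightarrow> mealy_out \<Lambda> s \<sigma> = mealy_out \<Lambda> t \<sigma> \<and>
      (mealy_deriv \<Lambda> s \<sigma>, mealy_deriv \<Lambda> t \<sigma>) \<in> R"
    by (auto simp: subst_closure_def bisim_fun_def)
  have "mealy_out \<Lambda> (subst \<theta> s) \<sigma> = mealy_out \<Lambda> (subst \<theta> t) \<sigma> \<and>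
      (mealy_deriv \<Lambda> (subst \<theta> s) \<sigma>, mealy_deriv \<Lambda> (subst \<theta> t) \<sigma>) \<in> subst_closure \<Sigma> V R"
    if \<sigma>: "\<sigma> \<in> V \<rightarrow> A" for \<sigma>
  proof -
    \<comment> \<open>Both instances involve the same derived input and substitution, so a single
      use of \<open>b\<close> and a single witness for \<open>subst_closure\<close> suffice.\<close>
    note ms = mealy_subst[OF assms(1) \<sigma> \<theta> st(1)] and mt = mealy_subst[OF assms(1) \<sigma> \<theta> st(2)]
    show ?thesis
      unfolding ms(1,2) mt(1,2) subst_closure_def using b[OF ms(3)] ms(4) by blast
  qed
  moreover have "subst \<theta> s \<in> terms \<Sigma> V" "subst \<theta> t \<in> terms \<Sigma> V"
    using subst_in_terms[OF st(1)] subst_in_terms[OF st(2)] \<theta> by blast+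
  ultimately show "p \<in> bisim_fun \<Sigma> V A \<Lambda> (subst_closure \<Sigma> V R)"
    by (simp add: p bisim_fun_def)
qed

end
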